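(* For all integers $n\geqslant 0$, we have $$s(n) = a_1(n) + \sum_{w \in 1\{0,1\}^*} s([\overline{w}]_2)\, a_{w1}(n),$$ where $s$ is the Stern sequence, $a_v(n)$ is the number of (possibly overlapping) occurrences of the word $v$ in the binary expansion of $n$, $\overline{w}$ is the bitwise complement of $w$, $[\overline{w}]_2$ is the integer represented by $\overline{w}$ in base $2$, and $w1$ is the word $w$ followed by the letter $1$. (For each $n$, only finitely many terms of the sum are nonzero.)
   Context: The Stern sequence $\{s(n)\}_{n\geqslant 0}$ is defined by $s(0)=0$, $s(1)=1$, and, for $n\geqslant 1$, $s(2n)=s(n)$ and $s(2n+1)=s(n)+s(n+1)$. $\{0,1\}^*$ is the set of all finite words (including the empty word) over the alphabet $\{0,1\}$, and $1\{0,1\}^*$ is the set of such words that begin with the letter $1$. For $v\in 1\{0,1\}^*$ and an integer $n\geqslant 0$, $a_v(n)$ denotes the number of (possibly overlapping) occurrences of $v$ as a contiguous block in the binary expansion of $n$ (most significant digit first, no leading zeros; in particular $a_v(0)=0$ for all such $v$). For $w\in\{0,1\}^*$, $\overline{w}$ denotes the complement of $w$, obtained by replacing each $0$ by $1$ and each $1$ by $0$ (so $\overline{w}$ has the same length as $w$ and may have leading zeros), and $[w]_2$ denotes the nonnegative integer specified by $w$ interpreted in base $2$, most significant digit first (leading zeros allowed). For a word $w$, $w1$ denotes the concatenation of $w$ with the letter $1$. *)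

theory Defs
  imports "HOL-Analysis.Infinite_Sum"
begin

function stern :: "nat \<Rightarrow> nat" where
  "stern n =
     (if n = 0 then 0
      else if n = 1 then 1
      else if even n then stern (n div 2)
      else stern (n div 2) + stern (n div 2 + 1))"
  by pat_completeness auto
termination
  by (relation "Wellfounded.measure id") (auto elim!: oddE)

declare stern.simps [simp del]

lemma stern_0: "stern 0 = 0"
  by (simp add: stern.simps)

lemma stern_1: "stern 1 = 1"
  by (simp add: stern.simps)

lemma stern_even: "n \<ge> 1 \<Longrightarrow> stern (2 * n) = stern n"
  by (subst stern.simps) auto

lemma stern_odd: "n \<ge> 1 \<Longrightarrow> stern (2 * n + 1) = stern n + stern (n + 1)"
  by (subst stern.simps) auto

text \<open>
  Words over $\{0,1\}$ are lists of Booleans, with \<open>True\<close> for the letter 1, read from left to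
  right, so that the head of the list is the most significant digit.
\<close>

type_synonym word = "bool list"

definition words_from_one :: "word set" where
  "words_from_one = range ((#) True)"

definition complement :: "word \<Rightarrow> word" where
  "complement w = map Not w"

text \<open>The library's \<^const>\<open>horner_sum\<close> expects the least significant digit first.\<close>

definition word_value :: "word \<Rightarrow> nat" where
  "word_value w = horner_sum of_bool 2 (rev w)"

text \<open>
  The expansion of 0 is taken to be the empty word. Representing it by the word 0 instead would
  not affect the number of occurrences of words beginning with 1.
\<close>

fun binary_expansion :: "nat \<Rightarrow> word" where
  "binary_expansion n = (if n = 0 then [] else binary_expansion (n div 2) @ [odd n])"

declare binary_expansion.simps [simp del]

lemma word_value_binary_expansion: "word_value (binary_expansion n) = n"
proof (induction n rule: binary_expansion.induct)
  case (1 n)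
  then show ?case
    by (subst binary_expansion.simps) (auto simp: word_value_def elim: evenE oddE)
qed

lemma binary_expansion_no_leading_zero: "n > 0 \<Longrightarrow> binary_expansion n \<in> words_from_one"
proof (induction n rule: binary_expansion.induct)
  case (1 n)
  show ?case
  proof (cases "n = 1")
    case True
    then show ?thesis
      by (simp add: binary_expansion.simps words_from_one_def)
  next
    case False
    with 1 show ?thesis
      by (subst binary_expansion.simps) (auto simp: words_from_one_def)
  qed
qed

text \<open>Occurrences are counted by their starting positions, so they may overlap.\<close>

definition occurrences :: "word \<Rightarrow> nat \<Rightarrow> nat" where
  "occurrences v n =
     (let b = binary_expansion n
      in card {i. i + length v \<le> length b \<and> take (length v) (drop i b) = v})"

end

theory Submission
  imports Defs "HOL-Library.Sublist"
begin

text \<open>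
  Appending the digit 1 to the expansion \<open>b\<close> of \<open>m\<close> creates one new occurrence of \<open>w1\<close> for each
  suffix \<open>w\<close> of \<open>b\<close>, and appending 0 creates none. As \<open>s(2m + 1) - s(m) = s(m + 1)\<close>, it suffices
  that \<open>s(m + 1)\<close> equals 1 plus the sum of the weights of the suffixes of \<open>b\<close> that begin with 1.
  This is proved by induction on the digits, simultaneously with the formula for \<open>s(m)\<close> in which
  every weight is replaced by the Stern value at the next integer.
\<close>

text \<open>The case \<open>n = 0\<close> is included because
  \<open>word_value (complement w)\<close> is 0 when \<open>w\<close> consists of ones only.\<close>

lemma stern_double: "stern (2 * n) = stern n"
  by (cases "n = 0") (auto simp: stern_even)

lemma stern_Suc_double: "stern (Suc (2 * n)) = stern n + stern (Suc n)"
  using stern_odd[of n] stern_0 stern_1 by (cases "n = 0") auto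

lemma stern_Suc_Suc_double: "stern (Suc (Suc (2 * n))) = stern (Suc n)"
  using stern_double[of "Suc n"] by simp

lemma binary_expansion_0: "binary_expansion 0 = []"
  by (simp add: binary_expansion.simps)

lemma binary_expansion_double:
  "n > 0 \<Longrightarrow> binary_expansion (2 * n) = binary_expansion n @ [False]"
  by (subst binary_expansion.simps) simp

lemma binary_expansion_Suc_double:
  "binary_expansion (Suc (2 * n)) = binary_expansion n @ [True]"
  by (subst binary_expansion.simps) simp

text \<open>Induction along the expansion. Appending 0 requires \<open>n > 0\<close>, since
  \<open>2 * 0\<close> has the same empty expansion as 0.\<close>

lemma binary_digits_induct [case_names zero double Suc_double]:
  fixes n :: nat
  assumes "P 0" "\<And>n. n > 0 \<Longrightarrow> P n \<Longrightarrow> P (2 * n)" "\<And>n. P n \<Longrightarrow> P (Suc (2 * n))"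
  shows "P n"
proof (induction n rule: less_induct)
  case (less n)
  consider "n = 0" | m where "n = 2 * m" "m > 0" | m where "n = Suc (2 * m)"
    by (cases "even n"; cases "n = 0") (auto elim!: evenE oddE)
  then show ?case
    using assms less by cases auto
qed

lemma word_value_complement_snoc:
  "word_value (complement (w @ [c])) = 2 * word_value (complement w) + of_bool (\<not> c)"
  by (simp add: word_value_def complement_def)

definition suffixes_from_one :: "word \<Rightarrow> word set" where
  "suffixes_from_one b = {w \<in> words_from_one. suffix w b}"

lemma finite_suffixes_from_one: "finite (suffixes_from_one b)"
  by (rule finite_subset[of _ "set (suffixes b)"]) (auto simp: suffixes_from_one_def)

lemma suffixes_from_one_Nil: "suffixes_from_one [] = {}"
  by (auto simp: suffixes_from_one_def words_from_one_def)

lemma Nil_notin_words_from_one: "[] \<notin> words_from_one"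
  by (auto simp: words_from_one_def)

lemma snoc_in_words_from_one:
  "w @ [c] \<in> words_from_one \<longleftrightarrow> w \<in> words_from_one \<or> w = [] \<and> c"
  by (cases w) (auto simp: words_from_one_def)

text \<open>Removing the last letter of a nonempty suffix leaves a suffix of \<open>b\<close>. It
  still begins with 1 unless it is empty, and that exception is the word
  \<open>[True]\<close>.\<close>

lemma suffixes_from_one_snoc:
  "suffixes_from_one (b @ [c]) =
     (\<lambda>w. w @ [c]) ` suffixes_from_one b \<union> (if c then {[True]} else {})"
proof (intro set_eqI)
  fix w
  show "w \<in> suffixes_from_one (b @ [c]) \<longleftrightarrow>
    w \<in> (\<lambda>w. w @ [c]) ` suffixes_from_one b \<union> (if c then {[True]} else {})"
    by (cases w rule: rev_cases)
      (auto simp: suffixes_from_one_def snoc_in_words_from_one image_iff Nil_notin_words_from_one)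
qed

lemma sum_suffixes_from_one_snoc:
  fixes f :: "word \<Rightarrow> nat"
  shows "(\<Sum>w\<in>suffixes_from_one (b @ [c]). f w) =
    (\<Sum>w\<in>suffixes_from_one b. f (w @ [c])) + (if c then f [True] else 0)"
proof -
  \<comment> \<open>The union is disjoint: \<open>[True]\<close> could only come from the empty
    word, which does not begin with 1.\<close>
  have "[True] \<notin> (\<lambda>w. w @ [True]) ` suffixes_from_one b"
    by (auto simp: suffixes_from_one_def words_from_one_def)
  then show ?thesis
    by (simp add: suffixes_from_one_snoc finite_suffixes_from_one sum.reindex inj_on_def
        add.commute)
qed

text \<open>Appending a digit to \<open>w\<close> appends the opposite digit to its complement, of
  value v. Appending 0 maps (s(n), s(n+1)) to (s(n), s(n) + s(n+1)) and (s(v), s(v+1)) to (s(v) +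
  s(v+1), s(v+1)); appending 1 exchanges these two rules. So the pair for v evolves like the pair
  for n with its entries swapped, which is why s(n) is matched with s(v+1) and s(n+1) with
  s(v).\<close>

lemma stern_suffix_sums:
  "stern n =
     (\<Sum>w\<in>suffixes_from_one (binary_expansion n). stern (Suc (word_value (complement w))))"
  "stern (Suc n) =
     Suc (\<Sum>w\<in>suffixes_from_one (binary_expansion n). stern (word_value (complement w)))"
proof (induction n rule: binary_digits_induct)
  case zero
  {
    case 1
    show ?case by (simp add: binary_expansion_0 suffixes_from_one_Nil stern_0)
  next
    case 2
    show ?case using stern_1 by (simp add: binary_expansion_0 suffixes_from_one_Nil)
  }
next
  case (double n)
  {
    case 1
    show ?case
      using double by (simp add: binary_expansion_double sum_suffixes_from_one_snoc
          word_value_complement_snoc stern_double stern_Suc_Suc_double)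
  next
    case 2
    show ?case
      using double by (simp add: binary_expansion_double sum_suffixes_from_one_snoc
          word_value_complement_snoc stern_Suc_double sum.distrib)
  }
next
  case (Suc_double n)
  \<comment> \<open>The new suffix \<open>[True]\<close> adds s(1) = 1 to the first sum, which
    accounts for the 1 in the formula for s(n+1), and s(0) = 0 to the second.\<close>
  have [simp]: "word_value (complement [True]) = 0"
    by (simp add: word_value_def complement_def)
  {
    case 1
    show ?case
      using Suc_double stern_1 by (simp add: binary_expansion_Suc_double
          sum_suffixes_from_one_snoc word_value_complement_snoc stern_Suc_double sum.distrib)
  next
    case 2
    show ?case
      using Suc_double by (simp add: binary_expansion_Suc_double sum_suffixes_from_one_snoc
          word_value_complement_snoc stern_double stern_Suc_Suc_double stern_0)
  }
qed

definition occurrence_positions :: "'a list \<Rightarrow> 'a list \<Rightarrow> nat set" where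
  "occurrence_positions v b = {i. i + length v \<le> length b \<and> take (length v) (drop i b) = v}"

lemma occurrences_eq_card: "occurrences v n = card (occurrence_positions v (binary_expansion n))"
  by (simp add: occurrences_def occurrence_positions_def Let_def)

lemma finite_occurrence_positions: "finite (occurrence_positions v b)"
  by (rule finite_subset[of _ "{..length b}"]) (auto simp: occurrence_positions_def)

lemma card_occurrence_positions_snoc:
  assumes "v \<noteq> []"
  shows "card (occurrence_positions v (b @ [c])) =
    card (occurrence_positions v b) + of_bool (suffix v (b @ [c]))"
proof -
  \<comment> \<open>The only start from which \<open>v\<close> can end at the appended digit. The
    subtraction truncates to 0 when \<open>v\<close> is longer than \<open>b @ [c]\<close>, but then
    \<open>v\<close> is not a suffix.\<close>
  let ?k = "Suc (length b) - length v"
  have "i \<in> occurrence_positions v (b @ [c]) \<longleftrightarrow>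
      i \<in> occurrence_positions v b \<or> i = ?k \<and> suffix v (b @ [c])" for i
  proof (cases "i + length v \<le> length b")
    case True
    then have "i \<noteq> ?k"
      by linarith
    with True show ?thesis
      by (simp add: occurrence_positions_def)
  next
    case False
    then have "i + length v \<le> length (b @ [c]) \<longleftrightarrow> i + length v = Suc (length b)"
      by auto
    moreover have "take (length v) (drop i (b @ [c])) = drop i (b @ [c])"
      if "i + length v = Suc (length b)"
      using that by (intro take_all) simp
    ultimately have "i \<in> occurrence_positions v (b @ [c]) \<longleftrightarrow>
        i + length v = Suc (length b) \<and> drop i (b @ [c]) = v"
      unfolding occurrence_positions_def mem_Collect_eq by metis
    also have "\<dots> \<longleftrightarrow> i = ?k \<and> suffix v (b @ [c])"
    proof
      assume i: "i + length v = Suc (length b) \<and> drop i (b @ [c]) = v"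
      then have "i = ?k"
        by linarith
      with i show "i = ?k \<and> suffix v (b @ [c])"
        using suffix_drop by metis
    next
      assume i: "i = ?k \<and> suffix v (b @ [c])"
      then obtain u where u: "b @ [c] = u @ v"
        by (auto simp only: suffix_def)
      then have "Suc (length b) = length u + length v"
        by (metis length_append length_append_singleton)
      with i have "i = length u" "i + length v = Suc (length b)"
        by linarith+
      then show "i + length v = Suc (length b) \<and> drop i (b @ [c]) = v"
        by (simp add: u del: drop_append) simp
    qed
    finally show ?thesis
      using False by (simp add: occurrence_positions_def)
  qed
  then have "occurrence_positions v (b @ [c]) =
      (if suffix v (b @ [c]) then insert ?k (occurrence_positions v b)
       else occurrence_positions v b)"
    by (intro set_eqI) (simp del: suffix_snoc, blast)
  moreover have "?k \<notin> occurrence_positions v b"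
    by (auto simp: occurrence_positions_def)
  ultimately show ?thesis
    by (simp add: finite_occurrence_positions)
qed

lemma occurrences_0: "v \<noteq> [] \<Longrightarrow> occurrences v 0 = 0"
  by (simp add: occurrences_eq_card occurrence_positions_def binary_expansion_0)

text \<open>A word ending in 1 is never a suffix of an expansion ending in 0.\<close>

lemma occurrences_double: "n > 0 \<Longrightarrow> occurrences (w @ [True]) (2 * n) = occurrences (w @ [True]) n"
  by (simp add: occurrences_eq_card binary_expansion_double card_occurrence_positions_snoc)

lemma occurrences_Suc_double:
  "occurrences (w @ [True]) (Suc (2 * n)) =
     occurrences (w @ [True]) n + of_bool (suffix w (binary_expansion n))"
  by (simp add: occurrences_eq_card binary_expansion_Suc_double card_occurrence_positions_snoc)

lemma occurrences_eq_0:
  "length (binary_expansion n) < length v \<Longrightarrow> occurrences v n = 0"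
  by (simp add: occurrences_eq_card occurrence_positions_def)

text \<open>One index set \<open>A\<close> serves throughout the induction: if it is large enough
  for \<open>2 * n\<close> or \<open>Suc (2 * n)\<close>, it is so for \<open>n\<close>, and the
  sums can be compared term by term.\<close>

lemma stern_eq_finite_sum:
  assumes "finite A" "A \<subseteq> words_from_one"
    and "{w \<in> words_from_one. length w \<le> length (binary_expansion n)} \<subseteq> A"
  shows "stern n = occurrences [True] n +
    (\<Sum>w\<in>A. stern (word_value (complement w)) * occurrences (w @ [True]) n)"
  using assms(3)
proof (induction n rule: binary_digits_induct)
  case zero
  show ?case by (simp add: occurrences_0 stern_0)
next
  case (double n)
  have "{w \<in> words_from_one. length w \<le> length (binary_expansion n)} \<subseteq> A"
    using double.prems double.hyps by (auto simp: binary_expansion_double)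
  with double show ?case
    using occurrences_double[of n "[]"] by (simp add: stern_double occurrences_double)
next
  case (Suc_double n)
  have sub: "{w \<in> words_from_one. length w \<le> length (binary_expansion n)} \<subseteq> A"
    using Suc_double.prems by (auto simp: binary_expansion_Suc_double)
  \<comment> \<open>No suffix is longer than the word itself, so \<open>A\<close> contains all
    suffixes beginning with 1.\<close>
  then have "suffixes_from_one (binary_expansion n) =
      {w \<in> A. suffix w (binary_expansion n)}"
    using assms(2) by (auto simp: suffixes_from_one_def dest: suffix_length_le)
  then have "stern (Suc n) = Suc (\<Sum>w\<in>A. stern (word_value (complement w)) *
      of_bool (suffix w (binary_expansion n)))"
    using stern_suffix_sums(2)[of n] assms(1)
    by (simp add: sum.inter_filter of_bool_def if_distrib cong: if_cong)
  \<comment> \<open>The empty word is a suffix of every word, so the count of \<open>[True]\<close>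
    grows by 1; this is the \<open>Suc\<close> in the formula for
    \<open>stern (Suc n)\<close>.\<close>
  with Suc_double.IH[OF sub] show ?case
    using occurrences_Suc_double[of "[]" n]
    by (simp add: stern_Suc_double occurrences_Suc_double distrib_left sum.distrib)
qed

text \<open>As \<open>infsum\<close> has the default value 0 on families that are not summable,
  finiteness of the support is recorded together with the value.\<close>

lemma infsum_eq_sum_of_support:
  fixes f :: "'a \<Rightarrow> 'b :: {comm_monoid_add, t2_space}"
  assumes "finite A" "A \<subseteq> S" and zero: "\<And>x. x \<in> S - A \<Longrightarrow> f x = 0"
  shows "finite {x \<in> S. f x \<noteq> 0}" "infsum f S = sum f A"
proof -
  have "{x \<in> S. f x \<noteq> 0} \<subseteq> A"
    using zero by auto
  then show "finite {x \<in> S. f x \<noteq> 0}"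
    using assms(1) by (rule finite_subset)
  have "infsum f S = infsum f A"
    using assms by (intro infsum_cong_neutral) auto
  then show "infsum f S = sum f A"
    using assms(1) by simp
qed

theorem theorem1p1:
  fixes n :: nat
  shows "finite {w \<in> words_from_one. stern (word_value (complement w)) * occurrences (w @ [True]) n \<noteq> 0} \<and>
    stern n = occurrences [True] n +
      (\<Sum>\<^sub>\<infinity>w\<in>words_from_one. stern (word_value (complement w)) * occurrences (w @ [True]) n)"
proof -
  let ?f = "\<lambda>w. stern (word_value (complement w)) * occurrences (w @ [True]) n"
  \<comment> \<open>Outside \<open>A\<close> the word \<open>w @ [True]\<close> is longer than the
    expansion of \<open>n\<close> and cannot occur in it.\<close>
  define A where "A = {w \<in> words_from_one. length w \<le> length (binary_expansion n)}"
  have "finite {w :: word. set w \<subseteq> UNIV \<and> length w \<le> length (binary_expansion n)}"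
    by (intro finite_lists_length_le) simp
  then have fin: "finite A"
    by (rule rev_finite_subset) (auto simp: A_def)
  have sub: "A \<subseteq> words_from_one"
    by (auto simp: A_def)
  have zero: "?f w = 0" if "w \<in> words_from_one - A" for w
  proof -
    have "occurrences (w @ [True]) n = 0"
      using that by (intro occurrences_eq_0) (auto simp: A_def)
    then show ?thesis
      by simp
  qed
  have "stern n = occurrences [True] n + sum ?f A"
    by (intro stern_eq_finite_sum fin sub) (simp add: A_def)
  also have "sum ?f A = infsum ?f words_from_one"
    by (rule infsum_eq_sum_of_support(2)[OF fin sub zero, symmetric])
  finally have "stern n = occurrences [True] n + infsum ?f words_from_one" .
  moreover have "finite {w \<in> words_from_one. ?f w \<noteq> 0}"
    by (rule infsum_eq_sum_of_support(1)[OF fin sub zero])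
  ultimately show ?thesis
    by (intro conjI)
qed

end
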